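(* For every punctual equivalence relation $R$, $R\equiv_{pr}R_{\overline{T_R}}$.
   Context: A punctual equivalence relation is a primitive recursive equivalence relation with domain $\omega$ having infinitely many equivalence classes. For equivalence relations $R,S$ on $\omega$, $R\leq_{pr} S$ means that there is a primitive recursive function $f:\omega\to\omega$ such that for all $x,y\in\omega$, $x\mathrel{R}y \Leftrightarrow f(x)\mathrel{S}f(y)$; $R\equiv_{pr}S$ means $R\leq_{pr}S$ and $S\leq_{pr}R$. For $X\subseteq\omega$, $R_X$ is the equivalence relation given by $x\mathrel{R_X}y \Leftrightarrow (x,y\in X \text{ or } x=y)$, and $\overline{X}=\omega\setminus X$. The principal transversal of $R$ is $T_R=\{y\neq 0 : (\forall x<y)\ \neg(x\mathrel{R}y)\}$. *)

theory Defs
  imports Main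
begin

text \<open>
  \<^term>\<open>prim_rec n F\<close>: \<^term>\<open>F\<close> represents an \<^term>\<open>n\<close>-ary primitive recursive function,
  an argument tuple being a list of length \<^term>\<open>n\<close>. The values of \<^term>\<open>F\<close> on lists of any
  other length carry no meaning; the arities in the rules ensure that they never influence the
  values on lists of length \<^term>\<open>n\<close>. The recursion variable is the first argument.
\<close>

inductive prim_rec :: "nat \<Rightarrow> (nat list \<Rightarrow> nat) \<Rightarrow> bool" where
  zero: "prim_rec n (\<lambda>xs. 0)"
| succ: "prim_rec 1 (\<lambda>xs. Suc (xs ! 0))"
| proj: "i < n \<Longrightarrow> prim_rec n (\<lambda>xs. xs ! i)"
| comp: "prim_rec (length fs) g \<Longrightarrow> (\<forall>f \<in> set fs. prim_rec n f) \<Longrightarrow>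
           prim_rec n (\<lambda>xs. g (map (\<lambda>f. f xs) fs))"
| prec: "prim_rec n g \<Longrightarrow> prim_rec (n + 2) h \<Longrightarrow>
           prim_rec (n + 1)
             (\<lambda>xs. rec_nat (g (tl xs)) (\<lambda>k r. h (k # r # tl xs)) (hd xs))"

definition prim_rec_fun :: "(nat \<Rightarrow> nat) \<Rightarrow> bool" where
  "prim_rec_fun f \<longleftrightarrow> (\<exists>F. prim_rec 1 F \<and> (\<forall>x. F [x] = f x))"

text \<open>A relation is primitive recursive if its characteristic function is.\<close>

definition prim_rec_rel :: "nat rel \<Rightarrow> bool" where
  "prim_rec_rel R \<longleftrightarrow> (\<exists>F. prim_rec 2 F \<and> (\<forall>x y. F [x, y] = of_bool ((x, y) \<in> R)))"

definition punctual_equiv :: "nat rel \<Rightarrow> bool" where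
  "punctual_equiv R \<longleftrightarrow> equiv UNIV R \<and> prim_rec_rel R \<and> infinite (UNIV // R)"

definition pr_reducible :: "nat rel \<Rightarrow> nat rel \<Rightarrow> bool" (infix "\<le>\<^sub>p\<^sub>r" 50) where
  "R \<le>\<^sub>p\<^sub>r S \<longleftrightarrow> (\<exists>f. prim_rec_fun f \<and> (\<forall>x y. (x, y) \<in> R \<longleftrightarrow> (f x, f y) \<in> S))"

definition pr_equivalent :: "nat rel \<Rightarrow> nat rel \<Rightarrow> bool" (infix "\<equiv>\<^sub>p\<^sub>r" 50) where
  "R \<equiv>\<^sub>p\<^sub>r S \<longleftrightarrow> R \<le>\<^sub>p\<^sub>r S \<and> S \<le>\<^sub>p\<^sub>r R"

definition collapse_rel :: "nat set \<Rightarrow> nat rel" where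
  "collapse_rel X = {(x, y). (x \<in> X \<and> y \<in> X) \<or> x = y}"

lemma equiv_collapse_rel: "equiv UNIV (collapse_rel X)"
  by (auto simp: collapse_rel_def intro!: equivI refl_onI symI transI)

definition principal_transversal :: "nat rel \<Rightarrow> nat set" where
  "principal_transversal R = {y. y \<noteq> 0 \<and> (\<forall>x<y. (x, y) \<notin> R)}"

end

theory Submission
  imports Defs
begin

text \<open>
  Write \<open>T\<close> for the principal transversal. Together with \<open>0\<close>, its elements are exactly the least
  elements of the \<open>R\<close>-classes, and \<open>0\<close> itself lies in the class of \<open>- T\<close>. Hence \<open>T \<union> {0}\<close> is a
  transversal of both relations: any two of its distinct elements are inequivalent for \<open>R\<close> and
  also for \<^term>\<open>collapse_rel (- principal_transversal R)\<close>. So a function into \<open>T \<union> {0}\<close>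
  whose kernel is one of the two relations is a reduction of that relation to the other one.

  From \<open>R\<close> one takes \<open>x\<close> to the least element of its class; from the collapsed relation one
  fixes \<open>T\<close> pointwise and takes everything else to \<open>0\<close>. Both values are found by a loop with
  \<open>x\<close> rounds whose body evaluates the characteristic function of \<open>R\<close> once
  (lemmas \<open>least_representative_search\<close> and \<open>transversal_test\<close>), so both functions are
  primitive recursive by \<open>prim_rec_fun_loop\<close>.
\<close>

lemma prim_rec_comp1:
  assumes "prim_rec 1 g" "prim_rec n a"
  shows "prim_rec n (\<lambda>xs. g [a xs])"
  using prim_rec.comp[of "[a]" g n] assms by simp

lemma prim_rec_comp2:
  assumes "prim_rec 2 g" "prim_rec n a" "prim_rec n b"
  shows "prim_rec n (\<lambda>xs. g [a xs, b xs])"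
  using prim_rec.comp[of "[a, b]" g n] assms by (simp add: numeral_2_eq_2)

lemma prim_rec_Suc:
  assumes "prim_rec n a"
  shows "prim_rec n (\<lambda>xs. Suc (a xs))"
  using prim_rec_comp1[OF prim_rec.succ assms] by simp

text \<open>
  Definition by cases is a recursion on the tested number whose step ignores the previous value.
\<close>

lemma prim_rec_if_zero:
  assumes "prim_rec n c" "prim_rec n a" "prim_rec n b"
  shows "prim_rec n (\<lambda>xs. if c xs = 0 then a xs else b xs)"
proof -
  define g :: "nat list \<Rightarrow> nat" where
    "g = (\<lambda>xs. rec_nat (tl xs ! 0) (\<lambda>k r. (k # r # tl xs) ! 3) (hd xs))"
  have "prim_rec (2 + 1) g"
    unfolding g_def by (intro prim_rec.prec prim_rec.proj) simp_all
  then have "prim_rec n (\<lambda>xs. g (map (\<lambda>f. f xs) [c, a, b]))"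
    using assms by (intro prim_rec.comp) (simp_all add: numeral_3_eq_3)
  moreover have "g [u, v, w] = (if u = 0 then v else w)" for u v w
    by (cases u) (simp_all add: g_def numeral_3_eq_3)
  ultimately show ?thesis by simp
qed

text \<open>
  A loop whose number of rounds equals its parameter: the two-place function given by primitive
  recursion is restricted to the diagonal.
\<close>

lemma prim_rec_fun_loop:
  assumes "prim_rec 1 g" "prim_rec 3 h"
  shows "prim_rec_fun (\<lambda>x. rec_nat (g [x]) (\<lambda>k r. h [k, r, x]) x)"
proof -
  let ?F = "\<lambda>xs. rec_nat (g (tl xs)) (\<lambda>k r. h (k # r # tl xs)) (hd xs)"
  have "prim_rec 2 ?F"
    using prim_rec.prec[of 1 g h] assms by (simp add: numeral_2_eq_2 numeral_3_eq_3)
  then have "prim_rec 1 (\<lambda>xs. ?F [xs ! 0, xs ! 0])"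
    by (intro prim_rec_comp2[of ?F] prim_rec.proj) simp_all
  then show ?thesis
    unfolding prim_rec_fun_def by (intro exI conjI) (assumption, simp)
qed

text \<open>
  Counting upwards from \<open>0\<close> and stalling at the first success yields the least witness as soon
  as the number of rounds reaches it.
\<close>

lemma least_representative_search:
  fixes P :: "nat \<Rightarrow> bool"
  assumes "P x"
  shows "rec_nat 0 (\<lambda>k r. if P r then r else Suc r) x = (LEAST i. P i)"
proof -
  have "rec_nat 0 (\<lambda>k r. if P r then r else Suc r) n = min n (LEAST i. P i)" for n
  proof (induction n)
    case (Suc n)
    have "P (LEAST i. P i)" using assms by (rule LeastI)
    moreover have "\<not> P n" if "n < (LEAST i. P i)" using that by (rule not_less_Least)
    ultimately show ?case using Suc by (cases n "LEAST i. P i" rule: linorder_cases) simp_all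
  qed simp
  then show ?thesis using Least_le[of P x, OF assms] by simp
qed

text \<open>
  The loop starts with \<open>x\<close> and drops to \<open>0\<close> forever at the first smaller equivalent number.
  At \<open>x = 0\<close>, which the transversal excludes, both sides are \<open>0\<close>.
\<close>

lemma transversal_test:
  "rec_nat x (\<lambda>k r. if (k, x) \<in> R then 0 else r) x =
    (if x \<in> principal_transversal R then x else 0)"
proof -
  have "rec_nat x (\<lambda>k r. if (k, x) \<in> R then 0 else r) n =
      (if \<forall>k<n. (k, x) \<notin> R then x else 0)" for n
    by (induction n) (auto simp: less_Suc_eq)
  then show ?thesis by (auto simp: principal_transversal_def)
qed

lemma prim_rec_fun_least_representative:
  assumes "prim_rec_rel R" "refl R"
  shows "prim_rec_fun (\<lambda>x. LEAST i. (i, x) \<in> R)"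
proof -
  obtain F where F: "prim_rec 2 F" "\<And>x y. F [x, y] = of_bool ((x, y) \<in> R)"
    using assms(1) unfolding prim_rec_rel_def by blast
  define h :: "nat list \<Rightarrow> nat" where
    "h = (\<lambda>xs. if F [xs ! 1, xs ! 2] = 0 then Suc (xs ! 1) else xs ! 1)"
  have "prim_rec 3 h"
    unfolding h_def
    by (intro prim_rec_if_zero prim_rec_comp2[OF F(1)] prim_rec_Suc prim_rec.proj) simp_all
  from prim_rec_fun_loop[OF prim_rec.zero this]
  have "prim_rec_fun (\<lambda>x. rec_nat 0 (\<lambda>k r. h [k, r, x]) x)" .
  moreover have "h [k, r, x] = (if (r, x) \<in> R then r else Suc r)" for k r x
    by (simp add: h_def F(2))
  moreover have "rec_nat 0 (\<lambda>k r. if (r, x) \<in> R then r else Suc r) x = (LEAST i. (i, x) \<in> R)"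
    for x
    using assms(2) by (intro least_representative_search) (simp add: refl_on_def)
  ultimately show ?thesis by simp
qed

lemma prim_rec_fun_retract_to_transversal:
  assumes "prim_rec_rel R"
  shows "prim_rec_fun (\<lambda>x. if x \<in> principal_transversal R then x else 0)"
proof -
  obtain F where F: "prim_rec 2 F" "\<And>x y. F [x, y] = of_bool ((x, y) \<in> R)"
    using assms unfolding prim_rec_rel_def by blast
  define h :: "nat list \<Rightarrow> nat" where
    "h = (\<lambda>xs. if F [xs ! 0, xs ! 2] = 0 then xs ! 1 else 0)"
  have "prim_rec 3 h"
    unfolding h_def
    by (intro prim_rec_if_zero prim_rec_comp2[OF F(1)] prim_rec.zero prim_rec.proj) simp_all
  from prim_rec_fun_loop[OF prim_rec.proj[of 0 1] this]
  have "prim_rec_fun (\<lambda>x. rec_nat x (\<lambda>k r. h [k, r, x]) x)" by simp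
  moreover have "h [k, r, x] = (if (k, x) \<in> R then 0 else r)" for k r x
    by (simp add: h_def F(2))
  ultimately show ?thesis by (simp add: transversal_test)
qed

lemma least_representative_equivalent:
  fixes R :: "nat rel"
  assumes "equiv UNIV R"
  shows "((LEAST i. (i, x) \<in> R), x) \<in> R"
  using assms by (intro LeastI[of "\<lambda>i. (i, x) \<in> R" x]) (simp add: equiv_def refl_on_def)

lemma least_representative_in_transversal:
  assumes "equiv UNIV R"
  shows "(LEAST i. (i, x) \<in> R) \<in> insert 0 (principal_transversal R)"
proof -
  let ?m = "LEAST i. (i, x) \<in> R"
  have "trans R" using assms by (simp add: equiv_def)
  then have "(k, x) \<in> R" if "(k, ?m) \<in> R" for k
    using that least_representative_equivalent[OF assms] by (rule transD)
  moreover have "(k, x) \<notin> R" if "k < ?m" for k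
    using that by (rule not_less_Least)
  ultimately have "\<forall>k<?m. (k, ?m) \<notin> R" by blast
  then show ?thesis unfolding principal_transversal_def by blast
qed

lemma least_representative_eq_iff:
  fixes R :: "nat rel"
  assumes "equiv UNIV R"
  shows "(LEAST i. (i, x) \<in> R) = (LEAST i. (i, y) \<in> R) \<longleftrightarrow> (x, y) \<in> R"
proof
  have "sym R" "trans R" using assms by (simp_all add: equiv_def)
  show "(x, y) \<in> R" if "(LEAST i. (i, x) \<in> R) = (LEAST i. (i, y) \<in> R)"
  proof -
    have "((LEAST i. (i, x) \<in> R), y) \<in> R"
      unfolding that by (rule least_representative_equivalent[OF assms])
    with symD[OF \<open>sym R\<close> least_representative_equivalent[OF assms]] show ?thesis
      by (rule transD[OF \<open>trans R\<close>])
  qed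
  show "(LEAST i. (i, x) \<in> R) = (LEAST i. (i, y) \<in> R)" if "(x, y) \<in> R"
  proof -
    have "(i, x) \<in> R \<longleftrightarrow> (i, y) \<in> R" for i
      using that \<open>sym R\<close> \<open>trans R\<close> by (blast dest: symD transD)
    then show ?thesis by simp
  qed
qed

text \<open>
  The larger of two distinct elements is nonzero, hence in the transversal, and so inequivalent
  to every smaller number.
\<close>

lemma equivalent_in_transversal_iff_eq:
  assumes "equiv UNIV R"
    and "a \<in> insert 0 (principal_transversal R)" "b \<in> insert 0 (principal_transversal R)"
  shows "(a, b) \<in> R \<longleftrightarrow> a = b"
proof -
  have no: "(a, b) \<notin> R" if "a < b" "b \<in> insert 0 (principal_transversal R)" for a b
    using that by (auto simp: principal_transversal_def)
  have "sym R" "(a, a) \<in> R" using assms(1) by (auto simp: equiv_def refl_on_def)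
  with no[of a b] no[of b a] assms(2,3) show ?thesis
    by (metis linorder_neqE_nat symE)
qed

lemma collapsed_in_transversal_iff_eq:
  assumes "a \<in> insert 0 (principal_transversal R)" "b \<in> insert 0 (principal_transversal R)"
  shows "(a, b) \<in> collapse_rel (- principal_transversal R) \<longleftrightarrow> a = b"
  using assms by (auto simp: collapse_rel_def)

theorem theorem3p1:
  fixes R :: "nat rel"
  assumes "punctual_equiv R"
  shows "R \<equiv>\<^sub>p\<^sub>r collapse_rel (- principal_transversal R)"
proof -
  let ?T = "principal_transversal R"
  have R: "equiv UNIV R" "prim_rec_rel R"
    using assms by (simp_all add: punctual_equiv_def)
  have "R \<le>\<^sub>p\<^sub>r collapse_rel (- ?T)"
    unfolding pr_reducible_def
  proof (intro exI conjI allI)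
    show "prim_rec_fun (\<lambda>x. LEAST i. (i, x) \<in> R)"
      using R by (intro prim_rec_fun_least_representative) (simp_all add: equiv_def)
    show "(x, y) \<in> R \<longleftrightarrow>
        ((LEAST i. (i, x) \<in> R), (LEAST i. (i, y) \<in> R)) \<in> collapse_rel (- ?T)" for x y
      using least_representative_eq_iff[OF R(1)]
        collapsed_in_transversal_iff_eq least_representative_in_transversal[OF R(1)] by metis
  qed
  moreover have "collapse_rel (- ?T) \<le>\<^sub>p\<^sub>r R"
    unfolding pr_reducible_def
  proof (intro exI conjI allI)
    let ?f = "\<lambda>x. if x \<in> ?T then x else 0"
    show "prim_rec_fun ?f"
      using R(2) by (rule prim_rec_fun_retract_to_transversal)
    fix x y
    have "0 \<notin> ?T" by (simp add: principal_transversal_def)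
    then have "(x, y) \<in> collapse_rel (- ?T) \<longleftrightarrow> ?f x = ?f y"
      by (auto simp: collapse_rel_def)
    also have "\<dots> \<longleftrightarrow> (?f x, ?f y) \<in> R"
      using equivalent_in_transversal_iff_eq[OF R(1), of "?f x" "?f y"] by simp
    finally show "(x, y) \<in> collapse_rel (- ?T) \<longleftrightarrow> (?f x, ?f y) \<in> R" .
  qed
  ultimately show ?thesis by (simp add: pr_equivalent_def)
qed

end
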